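(* Let $\kappa,T_{\rm i}>0$. If $\alpha_0$ and $T_0>0$ satisfy $\frac{T_{\rm i}}{T_0}>37.5964$ and $0<\alpha_0\le0.25$, then the thermodynamic part of the Hugoniot curve of $(\alpha_0,T_0)$, regarded as the graph of a function $T=T(\alpha)$, is strictly concave in a neighborhood of $(\alpha_0,T_0)$.
   Context: Model: one-dimensional ionized monatomic gas with degree of ionization $\alpha\in(0,1)$, temperature $T>0$, and constants $\kappa>0$ (Saha constant), $T_{\rm i}>0$ (ionization temperature). The pressure is $$p(\alpha,T)=\frac1\kappa\frac{1-\alpha^2}{\alpha^2}T^{5/2}e^{-T_{\rm i}/T},$$ and $\theta=(1+\alpha)T$. The thermodynamic part of the Hugoniot locus (Hugoniot curve) of $(\alpha_0,T_0)$ is the set of $(\alpha,T)\in(0,1)\times(0,\infty)$ such that, with $p=p(\alpha,T)$, $p_0=p(\alpha_0,T_0)$, $\theta_0=(1+\alpha_0)T_0$, $$\left(4+\frac{p}{p_0}\right)\theta_0+2T_{\rm i}\alpha_0=\left(4+\frac{p_0}{p}\right)\theta+2T_{\rm i}\alpha .$$ It is known that this set is the graph of a strictly increasing function $T=T(\alpha)$, $\alpha\in(0,1)$. Concavity is understood as that of this function of $\alpha$. *)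

theory Defs
  imports "HOL-Analysis.Analysis"
begin

text \<open>
  The degree of ionization is \<open>\<alpha> \<in> (0,1)\<close>, the temperature is \<open>T > 0\<close>, the Saha constant is
  \<open>\<kappa> > 0\<close> and the ionization temperature is \<open>Ti > 0\<close>. The functions below are total; their
  values outside these ranges are meaningless and are never used.
\<close>

definition pressure :: "real \<Rightarrow> real \<Rightarrow> real \<Rightarrow> real \<Rightarrow> real" where
  "pressure \<kappa> Ti \<alpha> T = 1 / \<kappa> * ((1 - \<alpha>\<^sup>2) / \<alpha>\<^sup>2) * T powr (5/2) * exp (- Ti / T)"

definition theta :: "real \<Rightarrow> real \<Rightarrow> real" where
  "theta \<alpha> T = (1 + \<alpha>) * T"

definition hugoniot_locus :: "real \<Rightarrow> real \<Rightarrow> real \<Rightarrow> real \<Rightarrow> (real \<times> real) set" where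
  "hugoniot_locus \<kappa> Ti \<alpha>\<^sub>0 T\<^sub>0 =
     {(\<alpha>, T). 0 < \<alpha> \<and> \<alpha> < 1 \<and> 0 < T \<and>
        (let p = pressure \<kappa> Ti \<alpha> T; p\<^sub>0 = pressure \<kappa> Ti \<alpha>\<^sub>0 T\<^sub>0;
             \<theta> = theta \<alpha> T; \<theta>\<^sub>0 = theta \<alpha>\<^sub>0 T\<^sub>0
         in (4 + p / p\<^sub>0) * \<theta>\<^sub>0 + 2 * Ti * \<alpha>\<^sub>0 = (4 + p\<^sub>0 / p) * \<theta> + 2 * Ti * \<alpha>)}"

text \<open>The strict counterpart of \<^const>\<open>concave_on\<close>.\<close>

definition strictly_concave_on :: "'a::real_vector set \<Rightarrow> ('a \<Rightarrow> real) \<Rightarrow> bool" where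
  "strictly_concave_on S f \<longleftrightarrow> convex S \<and>
     (\<forall>x\<in>S. \<forall>y\<in>S. \<forall>u>0. \<forall>v>0. x \<noteq> y \<longrightarrow> u + v = 1 \<longrightarrow>
        u * f x + v * f y < f (u *\<^sub>R x + v *\<^sub>R y))"

end

theory Submission
  imports Defs "HOL-Real_Asymp.Real_Asymp"
begin

text \<open>
  In the variables \<open>t = T / T\<^sub>0\<close> and \<open>c = Ti / T\<^sub>0\<close> the Hugoniot equation reads \<open>F \<alpha> t = 0\<close>,
  where \<open>F\<close> runs from \<open>-\<infinity>\<close> to \<open>\<infinity>\<close> in \<open>t\<close>. It need not be monotone, but its \<open>t\<close>-derivative is
  positive at every zero, so the zero is unique and depends on \<open>\<alpha>\<close> in a twice differentiable way.
  Implicit differentiation at the base point \<open>(\<alpha>\<^sub>0, 1)\<close>, with \<open>w = 1 / (\<alpha>\<^sub>0 (1 - \<alpha>\<^sub>0))\<close>, shows that the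
  second derivative has the sign of \<open>(4w + 5)\<^sup>2 / c + 12w + 10 - 4(1 - 3\<alpha>\<^sub>0\<^sup>2)w\<^sup>2\<close>. At
  \<open>\<alpha>\<^sub>0 = 1/4\<close>, where \<open>w = 16/3\<close>, this vanishes for \<open>c = 6241/166 = 37.59638\<dots>\<close>,
  which explains the numerical bound.
\<close>

section \<open>Real functions of one variable\<close>

text \<open>The mean value theorem on both sides of the intermediate point turns the secant slopes
  into values of \<open>f'\<close>, which are strictly ordered.\<close>

lemma strictly_concave_on_if_deriv_decreasing:
  fixes f f' :: "real \<Rightarrow> real"
  assumes S: "convex S"
    and der: "\<And>x. x \<in> S \<Longrightarrow> (f has_real_derivative f' x) (at x)"
    and dec: "\<And>x y. x \<in> S \<Longrightarrow> y \<in> S \<Longrightarrow> x < y \<Longrightarrow> f' y < f' x"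
  shows "strictly_concave_on S f"
proof -
  have less: "u * f x + v * f y < f (u * x + v * y)"
    if xS: "x \<in> S" and yS: "y \<in> S" and u: "u > 0" and v: "v > 0" and uv: "u + v = 1" and xy: "x < y"
    for x y u v
  proof -
    define z where "z = u * x + v * y"
    have u_eq: "u = 1 - v" using uv by simp
    have zx: "z - x = v * (y - x)" and yz: "y - z = u * (y - x)"
      unfolding z_def u_eq by algebra+
    have "0 < v * (y - x)" and "0 < u * (y - x)" using u v xy by simp_all
    then have lt: "x < z" "z < y" using zx yz by linarith+
    have "{x..y} \<subseteq> S"
      using closed_segment_subset[OF xS yS S] xy by (simp add: closed_segment_eq_real_ivl)
    then have sub: "t \<in> S" if "x \<le> t" "t \<le> y" for t using that by auto
    have "\<exists>\<xi>>x. \<xi> < z \<and> f z - f x = (z - x) * f' \<xi>"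
      by (rule MVT2[OF lt(1)]) (use lt in \<open>auto intro!: der sub\<close>)
    moreover have "\<exists>\<eta>>z. \<eta> < y \<and> f y - f z = (y - z) * f' \<eta>"
      by (rule MVT2[OF lt(2)]) (use lt in \<open>auto intro!: der sub\<close>)
    ultimately obtain \<xi> \<eta> where 1: "x < \<xi>" "\<xi> < z" "f z - f x = (z - x) * f' \<xi>"
      and 2: "z < \<eta>" "\<eta> < y" "f y - f z = (y - z) * f' \<eta>" by blast
    have d: "f' \<eta> < f' \<xi>" by (rule dec) (use sub 1 2 in auto)
    \<comment> \<open>By \<open>zx\<close> and \<open>yz\<close> both weighted lengths,
      \<open>u * (z - x)\<close> and \<open>v * (y - z)\<close>, equal
      \<open>u * v * (y - x)\<close>, so only the slopes remain to be compared.\<close>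
    have "u * (f z - f x) - v * (f y - f z) = u * v * (y - x) * (f' \<xi> - f' \<eta>)"
      unfolding 1 2 zx yz by algebra
    also have "\<dots> > 0" using u v xy d by simp
    finally have "u * f x + v * f y < (u + v) * f z" by (simp add: algebra_simps)
    then show ?thesis unfolding uv z_def by simp
  qed
  show ?thesis
    unfolding strictly_concave_on_def
  proof (intro conjI ballI allI impI)
    fix x y u v :: real
    assume *: "x \<in> S" "y \<in> S" "0 < u" "0 < v" "x \<noteq> y" "u + v = 1"
    show "u * f x + v * f y < f (u *\<^sub>R x + v *\<^sub>R y)"
    proof (cases "x < y")
      case True
      then show ?thesis using less[of x y u v] * by simp
    next
      case False
      then show ?thesis using less[of y x v u] * by (simp add: add.commute)
    qed
  qed (rule S)
qed

lemma strictly_concave_on_cmult: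
  fixes f :: "real \<Rightarrow> real"
  assumes "strictly_concave_on S f" and "k > 0"
  shows "strictly_concave_on S (\<lambda>x. k * f x)"
  unfolding strictly_concave_on_def
proof (intro conjI ballI allI impI)
  fix x y u v :: real
  assume "x \<in> S" "y \<in> S" "0 < u" "0 < v" "x \<noteq> y" "u + v = 1"
  then have "u * f x + v * f y < f (u *\<^sub>R x + v *\<^sub>R y)"
    using assms(1) unfolding strictly_concave_on_def by blast
  from mult_strict_left_mono[OF this \<open>k > 0\<close>]
  show "u * (k * f x) + v * (k * f y) < k * f (u *\<^sub>R x + v *\<^sub>R y)"
    by (simp add: algebra_simps)
qed (use assms(1) in \<open>simp add: strictly_concave_on_def\<close>)

text \<open>By continuity at \<open>a\<close>, \<open>f''\<close> stays negative on a small interval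
  inside \<open>U\<close>, where \<open>f'\<close> is then strictly decreasing.\<close>

lemma strictly_concave_on_nhd:
  fixes f f' f'' :: "real \<Rightarrow> real"
  assumes U: "open U" "a \<in> U"
    and f': "\<And>x. x \<in> U \<Longrightarrow> (f has_real_derivative f' x) (at x)"
    and f'': "\<And>x. x \<in> U \<Longrightarrow> (f' has_real_derivative f'' x) (at x)"
    and cont: "isCont f'' a" and neg: "f'' a < 0"
  obtains \<epsilon> where "\<epsilon> > 0" "{a - \<epsilon><..<a + \<epsilon>} \<subseteq> U" "strictly_concave_on {a - \<epsilon><..<a + \<epsilon>} f"
proof -
  have "\<forall>\<^sub>F x in at a. f'' x < 0"
    using cont neg unfolding isCont_def by (rule order_tendstoD)
  then have "\<forall>\<^sub>F x in nhds a. f'' x < 0"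
    using neg by (simp add: eventually_nhds_conv_at)
  then have "\<forall>\<^sub>F x in nhds a. f'' x < 0 \<and> x \<in> U"
    using U by (intro eventually_conj eventually_nhds_in_open)
  then obtain \<epsilon> where \<epsilon>: "\<epsilon> > 0" and *: "\<And>x. dist x a < \<epsilon> \<Longrightarrow> f'' x < 0 \<and> x \<in> U"
    unfolding eventually_nhds_metric by blast
  let ?I = "{a - \<epsilon><..<a + \<epsilon>}"
  have I: "f'' x < 0" "x \<in> U" if "x \<in> ?I" for x
    using *[of x] that by (auto simp: dist_real_def)
  have "strictly_concave_on ?I f"
  proof (rule strictly_concave_on_if_deriv_decreasing[where f' = f'])
    fix x y assume xy: "x \<in> ?I" "y \<in> ?I" "x < y"
    show "f' y < f' x"
    proof (rule DERIV_neg_imp_decreasing[OF xy(3)])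
      fix z assume "x \<le> z" "z \<le> y"
      then have "z \<in> ?I" using xy by auto
      then show "\<exists>d. (f' has_real_derivative d) (at z) \<and> d < 0" using I f'' by blast
    qed
  qed (use I f' in auto)
  with \<epsilon> I show ?thesis by (intro that) auto
qed

text \<open>Every zero is an upward crossing, but two neighbouring zeros cannot both be upward
  crossings. This takes the place of monotonicity of \<open>f\<close>.\<close>

lemma zero_unique_if_deriv_pos:
  fixes f f' :: "real \<Rightarrow> real"
  assumes der: "\<And>x. x \<in> {a..b} \<Longrightarrow> (f has_real_derivative f' x) (at x)"
    and pos: "\<And>x. x \<in> {a..b} \<Longrightarrow> f x = 0 \<Longrightarrow> f' x > 0"
    and zeros: "f a = 0" "f b = 0" and le: "a \<le> b"
  shows "a = b"
proof (rule ccontr)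
  assume "a \<noteq> b"
  then have ab: "a < b" using le by simp
  have cont: "continuous_on {a..b} f"
    by (meson DERIV_isCont continuous_at_imp_continuous_on der)
  obtain d where d: "d > 0" "\<And>h. 0 < h \<Longrightarrow> h < d \<Longrightarrow> f a < f (a + h)"
    using DERIV_pos_inc_right[OF der pos, of a] zeros ab by auto
  define e where "e = min (d / 2) ((b - a) / 2)"
  have e: "0 < e" "e < d" "a + e < b" using d ab by (auto simp: e_def min_def field_simps)
  \<comment> \<open>Cutting at \<open>a + e\<close> removes the zero \<open>a\<close> and keeps the
    set compact, so there is a first zero after \<open>a\<close>. Just to its left \<open>f\<close>
    is negative, while \<open>f (a + e)\<close> is positive, so an even earlier zero
    appears.\<close>
  define Z where "Z = {x \<in> {a + e..b}. f x = 0}"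
  have contZ: "continuous_on {a + e..b} f"
    using cont by (rule continuous_on_subset) (use e in auto)
  have "closed Z"
    unfolding Z_def using continuous_closed_preimage_constant[OF contZ] by simp
  moreover have "bounded Z"
    unfolding Z_def by (rule bounded_subset[of "{a..b}"]) (use e in auto)
  ultimately have "compact Z" by (simp add: compact_eq_bounded_closed)
  moreover have "b \<in> Z" using e zeros by (simp add: Z_def)
  ultimately obtain z where z: "z \<in> Z" "\<And>x. x \<in> Z \<Longrightarrow> z \<le> x"
    using compact_attains_inf[of Z] by blast
  have fe: "f (a + e) > 0" using d(2)[of e] e zeros by simp
  have zab: "z \<in> {a..b}" "f z = 0" "a + e \<le> z" using z(1) e by (auto simp: Z_def)
  have "z \<noteq> a + e" using fe zab(2) by auto
  then have ze: "a + e < z" using zab by simp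
  obtain d' where d': "d' > 0" "\<And>h. 0 < h \<Longrightarrow> h < d' \<Longrightarrow> f (z - h) < f z"
    using DERIV_pos_inc_left[OF der pos, of z] zab by auto
  define h where "h = min (d' / 2) ((z - (a + e)) / 2)"
  have h: "0 < h" "h < d'" "a + e < z - h" using d' ze by (auto simp: h_def min_def field_simps)
  have "f (z - h) \<le> 0" using d'(2)[of h] h zab by simp
  moreover have "continuous_on {a + e..z - h} f"
    using contZ by (rule continuous_on_subset) (use zab h in auto)
  ultimately obtain x where "a + e \<le> x" "x \<le> z - h" "f x = 0"
    using IVT2'[of f "z - h" 0 "a + e"] fe h by auto
  then have "x \<in> Z" using zab h by (auto simp: Z_def)
  then show False using z(2)[of x] \<open>x \<le> z - h\<close> h by simp
qed

section \<open>Pointwise inequalities\<close>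

text \<open>For \<open>A = 1 + a\<close>, \<open>B = (1 + x) * t\<close>, the pressure ratio
  \<open>P\<close> and \<open>m = 5/2 + c / t\<close> the conclusion says that
  \<open>t * Ft x t\<close> is positive. The premise \<open>le\<close> is what a zero of
  \<open>F\<close> yields for \<open>a \<le> x\<close>.\<close>

lemma ineq_right:
  fixes A B P m :: real
  assumes pos: "A > 0" "B > 0" "P > 0" and m: "m > 5/2"
    and le: "(4 + 1 / P) * B \<le> (4 + P) * A"
  shows "0 < A * P * m + B * (m - 1) / P - 4 * B"
proof -
  have le': "(4 * P + 1) * B \<le> P * (4 + P) * A"
    using le pos by (simp add: field_simps)
  have "0 \<le> 5/2 * A * P\<^sup>2 + 3/2 * B - 4 * B * P"
  \<comment> \<open>The coefficient of \<open>B\<close> is \<open>3/2 - 4 * P\<close>. If it is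
    nonnegative, all terms are; otherwise the upper bound \<open>le'\<close> for \<open>B\<close>
    may be inserted, and a multiple of \<open>(P - 1)\<^sup>2\<close> is left.\<close>
  proof (cases "4 * P \<le> 3/2")
    case True
    have "4 * P * B \<le> 3/2 * B" using True pos by (intro mult_right_mono) auto
    moreover have "0 \<le> 5/2 * A * P\<^sup>2" using pos by simp
    ultimately show ?thesis by (simp add: mult.commute mult.left_commute)
  next
    case False
    have "0 \<le> 6 * A * P * (P - 1)\<^sup>2" using pos by simp
    also have "\<dots> = 5/2 * A * P\<^sup>2 * (4 * P + 1) - (4 * P - 3/2) * (P * (4 + P) * A)"
      by (simp add: power2_eq_square algebra_simps)
    also have "\<dots> \<le> 5/2 * A * P\<^sup>2 * (4 * P + 1) - (4 * P - 3/2) * ((4 * P + 1) * B)"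
      using mult_left_mono[OF le', of "4 * P - 3/2"] False by simp
    also have "\<dots> = (4 * P + 1) * (5/2 * A * P\<^sup>2 + 3/2 * B - 4 * B * P)"
      by (simp add: power2_eq_square algebra_simps)
    finally show ?thesis using pos by (simp add: zero_le_mult_iff)
  qed
  also have "\<dots> < A * P\<^sup>2 * m + B * (m - 1) - 4 * B * P"
  proof -
    have "(5/2) * (A * P\<^sup>2 + B) < m * (A * P\<^sup>2 + B)"
      using m pos by (intro mult_strict_right_mono) (auto intro: add_pos_pos)
    then show ?thesis by (simp add: algebra_simps)
  qed
  also have "\<dots> = P * (A * P * m + B * (m - 1) / P - 4 * B)"
    using pos by (simp add: power2_eq_square field_simps)
  finally show ?thesis using pos by (simp add: zero_less_mult_iff)
qed

text \<open>The same quantity for \<open>x < a\<close>. Replacing \<open>A\<close> by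
  \<open>B\<close> and \<open>m\<close> by \<open>9/2\<close> leaves a quadratic in \<open>P\<close>
  without real roots.\<close>

lemma ineq_left:
  fixes A B P m :: real
  assumes pos: "B > 0" "P > 0" and m: "m \<ge> 9/2" and le: "B \<le> A"
  shows "0 < A * P * m + B * (m - 1) / P - 4 * B"
proof -
  have "0 < (P - 1/2)\<^sup>2 * 4 + P\<^sup>2 / 2 + 5/2" by (simp add: add_nonneg_pos)
  also have "\<dots> = 9/2 * P\<^sup>2 + 7/2 - 4 * P" by (simp add: power2_eq_square algebra_simps)
  finally have "0 < B * (9/2 * P\<^sup>2 + 7/2 - 4 * P)" using pos by simp
  also have "\<dots> = B * P\<^sup>2 * (9/2) + B * (9/2 - 1) - 4 * B * P" by (simp add: algebra_simps)
  also have "\<dots> \<le> A * P\<^sup>2 * m + B * (m - 1) - 4 * B * P"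
  proof -
    have "B * P\<^sup>2 * (9/2) \<le> A * P\<^sup>2 * m"
      using m pos le by (intro mult_mono) auto
    moreover have "B * (9/2 - 1) \<le> B * (m - 1)"
      using m pos by (intro mult_left_mono) auto
    ultimately show ?thesis by linarith
  qed
  also have "\<dots> = P * (A * P * m + B * (m - 1) / P - 4 * B)"
    using pos by (simp add: power2_eq_square field_simps)
  finally show ?thesis using pos by (simp add: zero_less_mult_iff)
qed

text \<open>The extreme case is \<open>a = 1/4\<close>: there \<open>a * (1 - a) = 3/16\<close>, so
  \<open>w = 16/3\<close>, and \<open>4 * (1 - 3 * a\<^sup>2) = 13/4\<close>.\<close>

lemma ineq_curvature:
  fixes a c w :: real
  assumes a: "0 < a" "a \<le> 1/4" and c: "c > 37.5964" and w: "w = 1 / (a * (1 - a))"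
  shows "(4 * w + 5)\<^sup>2 / c + 10 + 12 * w < 4 * (1 - 3 * a\<^sup>2) * w\<^sup>2"
proof -
  have "0 \<le> (1/4 - a) * (3/4 - a)" using a by (intro mult_nonneg_nonneg) auto
  also have "\<dots> = 3/16 - a * (1 - a)" by (simp add: field_simps)
  finally have aa: "0 < a * (1 - a)" "a * (1 - a) \<le> 3/16" using a by simp_all
  have w16: "w \<ge> 16/3" using aa unfolding w by (simp add: field_simps)
  have a2: "a\<^sup>2 \<le> 1/16" using power_mono[OF a(2), of 2] a by (simp add: power2_eq_square)
  have "(4 * w + 5)\<^sup>2 / c < (4 * w + 5)\<^sup>2 / 37.5964"
    using c w16 by (intro divide_strict_left_mono) auto
  moreover have "(4 * w + 5)\<^sup>2 / 37.5964 + 10 + 12 * w \<le> 13/4 * w\<^sup>2"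
  proof -
    \<comment> \<open>This bounds \<open>w\<^sup>2\<close> below by its tangent at
      \<open>16/3\<close>. Its total coefficient is positive, so a linear inequality for
      \<open>w \<ge> 16/3\<close> remains.\<close>
    have "0 \<le> (w - 16/3) * (w - 16/3)" by simp
    then show ?thesis using w16 by (simp add: power2_eq_square field_simps)
  qed
  moreover have "13/4 * w\<^sup>2 \<le> 4 * (1 - 3 * a\<^sup>2) * w\<^sup>2"
    using a2 by (intro mult_right_mono) auto
  ultimately show ?thesis by linarith
qed

section \<open>The normalised Hugoniot equation\<close>

text \<open>Here \<open>a\<close> is \<alpha>\<open>\<^sub>0\<close> and \<open>c\<close> is
  \<open>Ti / T\<^sub>0\<close>. The graph property is derived under \<open>c_ge_2\<close>; the
  sharp numerical bounds enter with the curvature.\<close>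

locale hugoniot =
  fixes a c :: real
  assumes a_pos: "0 < a" and a_less_1: "a < 1" and c_ge_2: "2 \<le> c"
begin

text \<open>The logarithm of the pressure ratio \<open>p / p\<^sub>0\<close>; \<open>\<gamma>\<close> below is its partial derivative in \<open>x\<close>.\<close>

definition L :: "real \<Rightarrow> real \<Rightarrow> real" where
  "L x t = ln ((1 - x\<^sup>2) / x\<^sup>2) - ln ((1 - a\<^sup>2) / a\<^sup>2) + 5/2 * ln t + c * (1 - 1 / t)"

text \<open>Left minus right side of the Hugoniot equation, divided by \<open>T\<^sub>0\<close>.
  Both pressure ratios are written as exponentials, so that differentiating them involves no
  quotient.\<close>

definition F :: "real \<Rightarrow> real \<Rightarrow> real" where
  "F x t = (4 + exp (L x t)) * (1 + a) + 2 * c * (a - x) - (4 + exp (- L x t)) * ((1 + x) * t)"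

definition \<gamma> :: "real \<Rightarrow> real" where
  "\<gamma> x = - 2 / (x * (1 - x\<^sup>2))"

definition \<gamma>' :: "real \<Rightarrow> real" where
  "\<gamma>' x = 2 * (1 - 3 * x\<^sup>2) / (x * (1 - x\<^sup>2))\<^sup>2"

definition Fx :: "real \<Rightarrow> real \<Rightarrow> real" where
  "Fx x t = \<gamma> x * (exp (L x t) * (1 + a) + exp (- L x t) * ((1 + x) * t))
      - 2 * c - (4 + exp (- L x t)) * t"

definition Ft :: "real \<Rightarrow> real \<Rightarrow> real" where
  "Ft x t = exp (L x t) * (1 + a) * (5 / (2 * t) + c / t\<^sup>2)
      + exp (- L x t) * (1 + x) * (3/2 + c / t) - 4 * (1 + x)"

section \<open>Derivatives and limits of the normalised equation\<close>

lemma square_less_1: "x\<^sup>2 < 1" if "0 < x" "x < 1" for x :: real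
  using that by (simp add: power_less_one_iff)

lemma DERIV_\<gamma>:
  assumes x: "0 < x" "x < 1"
  shows "(\<gamma> has_real_derivative \<gamma>' x) (at x)"
  unfolding \<gamma>_def
proof -
  have nz: "x * (1 - x\<^sup>2) \<noteq> 0" using square_less_1[OF x] x by simp
  show "((\<lambda>x. - 2 / (x * (1 - x\<^sup>2))) has_real_derivative \<gamma>' x) (at x)"
    by (rule derivative_eq_intros refl nz)+
      (use nz in \<open>simp add: \<gamma>'_def divide_simps power2_eq_square algebra_simps\<close>)
qed

text \<open>The arbitrary curve \<open>(g s, h s)\<close> lets one chain rule serve both for the
  partial derivatives of \<open>F\<close> and for the total derivative along
  \<open>t = \<tau> x\<close>.\<close>

lemma DERIV_L:
  assumes g: "(g has_real_derivative g') (at s)" and h: "(h has_real_derivative h') (at s)"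
    and x: "0 < g s" "g s < 1" and t: "0 < h s"
  shows "((\<lambda>s. L (g s) (h s)) has_real_derivative
           \<gamma> (g s) * g' + (5 / (2 * h s) + c / (h s)\<^sup>2) * h') (at s)"
proof -
  have sq: "(g s)\<^sup>2 < 1" using square_less_1[OF x] .
  have side: "(g s)\<^sup>2 \<noteq> 0" "0 < (1 - (g s)\<^sup>2) / (g s)\<^sup>2" "h s \<noteq> 0" using sq x t by simp_all
  have nz: "g s \<noteq> 0" "1 - (g s)\<^sup>2 \<noteq> 0" using sq x by simp_all
  have "((\<lambda>s. (1 - (g s)\<^sup>2) / (g s)\<^sup>2) has_real_derivative - 2 * g' / (g s) ^ 3) (at s)"
    by (rule derivative_eq_intros refl g side)+
      (use nz in \<open>simp add: field_simps power2_eq_square power3_eq_cube\<close>)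
  from DERIV_chain2[OF DERIV_ln_divide[OF side(2)] this]
  have "((\<lambda>s. ln ((1 - (g s)\<^sup>2) / (g s)\<^sup>2)) has_real_derivative
      1 / ((1 - (g s)\<^sup>2) / (g s)\<^sup>2) * (- 2 * g' / (g s) ^ 3)) (at s)" .
  moreover have "1 / ((1 - (g s)\<^sup>2) / (g s)\<^sup>2) * (- 2 * g' / (g s) ^ 3) = \<gamma> (g s) * g'"
    using nz by (simp add: \<gamma>_def power2_eq_square power3_eq_cube)
  ultimately have 1: "((\<lambda>s. ln ((1 - (g s)\<^sup>2) / (g s)\<^sup>2)) has_real_derivative \<gamma> (g s) * g') (at s)"
    by simp
  have 2: "((\<lambda>s. 5/2 * ln (h s) + c * (1 - 1 / h s)) has_real_derivative
      (5 / (2 * h s) + c / (h s)\<^sup>2) * h') (at s)"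
    by (rule derivative_eq_intros refl h t side)+
      (use t in \<open>simp add: field_simps power2_eq_square\<close>)
  have "((\<lambda>s. ln ((1 - (g s)\<^sup>2) / (g s)\<^sup>2) - ln ((1 - a\<^sup>2) / a\<^sup>2) +
      (5/2 * ln (h s) + c * (1 - 1 / h s))) has_real_derivative
      \<gamma> (g s) * g' - 0 + (5 / (2 * h s) + c / (h s)\<^sup>2) * h') (at s)"
    by (intro DERIV_add DERIV_diff DERIV_const 1 2)
  then show ?thesis by (simp add: L_def add.assoc)
qed

lemma DERIV_F:
  assumes g: "(g has_real_derivative g') (at s)" and h: "(h has_real_derivative h') (at s)"
    and x: "0 < g s" "g s < 1" and t: "0 < h s"
  shows "((\<lambda>s. F (g s) (h s)) has_real_derivative Fx (g s) (h s) * g' + Ft (g s) (h s) * h') (at s)"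
  unfolding F_def
  by (rule derivative_eq_intros DERIV_L g h x t refl)+
    (use t in \<open>simp add: Fx_def Ft_def, simp add: field_simps power2_eq_square\<close>)

lemma DERIV_F_snd:
  assumes "0 < x" "x < 1" "0 < t"
  shows "(F x has_real_derivative Ft x t) (at t)"
  using DERIV_F[where g = "\<lambda>_. x" and h = "\<lambda>t. t", OF DERIV_const DERIV_ident] assms by simp

lemma DERIV_F_fst:
  assumes "0 < x" "x < 1" "0 < t"
  shows "((\<lambda>x. F x t) has_real_derivative Fx x t) (at x)"
  using DERIV_F[where g = "\<lambda>x. x" and h = "\<lambda>_. t", OF DERIV_ident DERIV_const] assms by simp

lemma tendsto_L:
  assumes "(g \<longlongrightarrow> x) A" "(h \<longlongrightarrow> t) A" "0 < x" "x < 1" "0 < t"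
  shows "((\<lambda>s. L (g s) (h s)) \<longlongrightarrow> L x t) A"
  unfolding L_def using assms square_less_1[of x] by (auto intro!: tendsto_intros)

lemma tendsto_Ft:
  assumes "(g \<longlongrightarrow> x) A" "(h \<longlongrightarrow> t) A" "0 < x" "x < 1" "0 < t"
  shows "((\<lambda>s. Ft (g s) (h s)) \<longlongrightarrow> Ft x t) A"
  unfolding Ft_def using assms by (auto intro!: tendsto_intros tendsto_L)

section \<open>Sign of the \<open>t\<close>-derivative at zeros\<close>

lemma L_strict_antimono_fst:
  assumes "0 < x" "x < y" "y < 1"
  shows "L y t < L x t"
proof -
  have *: "(1 - z\<^sup>2) / z\<^sup>2 = 1 / z\<^sup>2 - 1" if "z > 0" for z :: real
    using that by (simp add: field_simps)
  have "x\<^sup>2 < y\<^sup>2" using assms by (intro power_strict_mono) auto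
  then have "1 / y\<^sup>2 < 1 / x\<^sup>2" using assms by (intro divide_strict_left_mono) auto
  then have "(1 - y\<^sup>2) / y\<^sup>2 < (1 - x\<^sup>2) / x\<^sup>2" using assms by (simp add: *)
  moreover have "0 < (1 - y\<^sup>2) / y\<^sup>2" using square_less_1[of y] assms by simp
  ultimately have "ln ((1 - y\<^sup>2) / y\<^sup>2) < ln ((1 - x\<^sup>2) / x\<^sup>2)" by simp
  then show ?thesis by (simp add: L_def)
qed

text \<open>This forces zeros to the left of \<open>a\<close> below \<open>t = 1\<close>. Moving
  left from \<open>a\<close> raises the pressure ratio, and already at \<open>a\<close> it grows
  fast enough in \<open>t\<close> to outweigh the right side.\<close>

lemma F_pos_if_left_ge_1:
  assumes x: "0 < x" "x < a" and t: "1 \<le> t"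
  shows "F x t > 0"
proof -
  define P where "P = exp (L x t)"
  have P_pos: "P > 0" by (simp add: P_def)
  \<comment> \<open>Lowering \<open>5/2\<close> and \<open>c\<close> to 2 makes the exponential
    \<open>t\<^sup>2\<close> times a factor bounded by \<open>exp y \<ge> 1 + y\<close>; hence the
    polynomial bound \<open>3 * t\<^sup>2 - 2 * t\<close> for \<open>P\<close>.\<close>
  have "2 * ln t + 2 * (1 - 1 / t) \<le> 5/2 * ln t + c * (1 - 1 / t)"
    using t c_ge_2 by (intro add_mono mult_right_mono) auto
  also have "\<dots> = L a t" by (simp add: L_def)
  also have "\<dots> < L x t" using x a_less_1 by (intro L_strict_antimono_fst)
  finally have "exp (2 * ln t + 2 * (1 - 1 / t)) < P" unfolding P_def by simp
  moreover have "exp (2 * ln t + 2 * (1 - 1 / t)) = t\<^sup>2 * exp (2 * (1 - 1 / t))"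
    using t by (simp add: exp_add exp_double)
  moreover have "t\<^sup>2 * (1 + 2 * (1 - 1 / t)) \<le> t\<^sup>2 * exp (2 * (1 - 1 / t))"
    by (intro mult_left_mono exp_ge_add_one_self) auto
  moreover have "t\<^sup>2 * (1 + 2 * (1 - 1 / t)) = 3 * t\<^sup>2 - 2 * t"
    using t by (simp add: field_simps power2_eq_square)
  ultimately have P: "3 * t\<^sup>2 - 2 * t < P" by linarith
  have "t * (3 * t - 3) \<ge> 0" using t by simp
  then have "t \<le> P" using P by (simp add: algebra_simps power2_eq_square)
  then have "t / P \<le> 1" using P_pos by simp
  moreover have "0 \<le> 3 * (t - 1)\<^sup>2" by simp
  ultimately have "4 * t + t / P \<le> 4 + P"
    using P by (simp add: power2_eq_square algebra_simps)
  then have "(4 * t + t / P) * (1 + a) \<le> (4 + P) * (1 + a)"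
    using a_pos by (intro mult_right_mono) auto
  moreover have "(4 * t + t / P) * (1 + x) \<le> (4 * t + t / P) * (1 + a)"
    using x t P_pos by (intro mult_left_mono) auto
  moreover have "(4 + 1 / P) * ((1 + x) * t) = (4 * t + t / P) * (1 + x)"
    by (simp add: field_simps)
  moreover have "0 < 2 * c * (a - x)" using c_ge_2 x by simp
  ultimately have "(4 + 1 / P) * ((1 + x) * t) < (4 + P) * (1 + a) + 2 * c * (a - x)" by linarith
  then show ?thesis
    by (simp add: F_def P_def exp_minus inverse_eq_divide)
qed

text \<open>At a zero with \<open>a \<le> x\<close> the equation supplies the premise of
  \<open>ineq_right\<close>. With \<open>x < a\<close> it forces \<open>t < 1\<close>, hence
  \<open>m \<ge> 9/2\<close>, and \<open>ineq_left\<close> applies.\<close>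

lemma Ft_pos:
  assumes x: "0 < x" "x < 1" and t: "0 < t" and zero: "F x t = 0"
  shows "Ft x t > 0"
proof -
  define P where "P = exp (L x t)"
  define m where "m = 5/2 + c / t"
  let ?A = "1 + a" and ?B = "(1 + x) * t"
  have pos: "?A > 0" "?B > 0" "P > 0" using a_pos x t by (simp_all add: P_def)
  have zero': "(4 + P) * ?A + 2 * c * (a - x) = (4 + 1 / P) * ?B"
    using zero by (simp add: F_def P_def exp_minus inverse_eq_divide)
  have "0 < ?A * P * m + ?B * (m - 1) / P - 4 * ?B"
  proof (cases "a \<le> x")
    case True
    have "2 * c * (a - x) \<le> 0" using True c_ge_2 by (simp add: mult_nonneg_nonpos)
    then have "(4 + 1 / P) * ?B \<le> (4 + P) * ?A" using zero' by linarith
    moreover have "m > 5/2" using c_ge_2 t by (simp add: m_def)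
    ultimately show ?thesis using pos by (intro ineq_right)
  next
    case False
    then have t1: "t < 1" using F_pos_if_left_ge_1[of x t] x zero by fastforce
    have "c \<le> c / t" using t1 t c_ge_2 by (simp add: field_simps)
    then have "m \<ge> 9/2" unfolding m_def using c_ge_2 by linarith
    moreover have "?B \<le> ?A * 1" using False x t t1 by (intro mult_mono) auto
    ultimately show ?thesis using pos by (intro ineq_left) auto
  qed
  also have "\<dots> = t * Ft x t"
    using t pos by (simp add: Ft_def m_def exp_minus inverse_eq_divide field_simps power2_eq_square flip: P_def)
  finally show ?thesis using t by (simp add: zero_less_mult_iff)
qed

section \<open>The Hugoniot curve as a graph\<close>

text \<open>For large \<open>t\<close> the term \<open>exp (L x t)\<close>, of order
  \<open>t powr (5/2)\<close>, beats the linear term; near 0 the factor \<open>exp (c / t)\<close>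
  in \<open>exp (- L x t)\<close> dominates with negative sign.\<close>

lemma filterlim_F:
  assumes "0 < x" "x < 1"
  shows "filterlim (F x) at_top at_top" "filterlim (F x) at_bot (at_right 0)"
proof -
  \<comment> \<open>Everything independent of \<open>t\<close> becomes an atom, leaving
    \<open>real_asymp\<close> a function of \<open>t\<close> with positive \<open>A\<close>,
    \<open>B\<close>, \<open>c\<close>.\<close>
  define A B k d where "A = 1 + a" and "B = 1 + x"
    and "k = ln ((1 - x\<^sup>2) / x\<^sup>2) - ln ((1 - a\<^sup>2) / a\<^sup>2)" and "d = 2 * c * (a - x)"
  have pos: "A > 0" "B > 0" "c > 0" using assms a_pos c_ge_2 by (simp_all add: A_def B_def)
  have F: "F x = (\<lambda>t. (4 + exp (k + 5/2 * ln t + c * (1 - 1 / t))) * A + d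
      - (4 + exp (- (k + 5/2 * ln t + c * (1 - 1 / t)))) * (B * t))"
    by (simp add: fun_eq_iff F_def L_def A_def B_def k_def d_def)
  show "filterlim (F x) at_top at_top" unfolding F using pos by real_asymp
  show "filterlim (F x) at_bot (at_right 0)" unfolding F using pos by real_asymp
qed

lemma F_eventually_pos: "0 < x \<Longrightarrow> x < 1 \<Longrightarrow> \<forall>\<^sub>F t in at_top. F x t > 0"
  using filterlim_F(1)[of x] by (simp add: filterlim_at_top_dense)

lemma F_eventually_neg: "0 < x \<Longrightarrow> x < 1 \<Longrightarrow> \<forall>\<^sub>F t in at_right 0. F x t < 0"
  using filterlim_F(2)[of x] by (simp add: filterlim_at_bot_dense)

lemma continuous_on_F:
  assumes "0 < x" "x < 1" "0 < s"
  shows "continuous_on {s..t} (F x)"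
  using assms by (intro continuous_at_imp_continuous_on ballI DERIV_isCont[OF DERIV_F_snd]) auto

lemma F_zero_unique:
  assumes x: "0 < x" "x < 1" and s: "0 < s" "F x s = 0" and t: "0 < t" "F x t = 0"
  shows "s = t"
proof -
  have *: "s = t" if "0 < s" "F x s = 0" "F x t = 0" "s \<le> t" for s t
    by (rule zero_unique_if_deriv_pos[where f = "F x" and f' = "Ft x"])
      (use that x in \<open>auto intro!: DERIV_F_snd Ft_pos\<close>)
  show ?thesis using *[of s t] *[of t s] s t by linarith
qed

lemma F_has_zero:
  assumes x: "0 < x" "x < 1"
  shows "\<exists>t>0. F x t = 0"
proof -
  obtain s where s: "s > 0" "F x s < 0"
    using eventually_happens'[OF _ eventually_conj[OF F_eventually_neg[OF x] eventually_at_right_less]]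
    by auto
  obtain t where t: "s \<le> t" "F x t > 0"
    using eventually_happens'[OF _ eventually_conj[OF F_eventually_pos[OF x] eventually_ge_at_top[of s]]]
    by auto
  obtain r where "s \<le> r" "F x r = 0"
    using IVT'[of "F x" s 0 t] s t continuous_on_F[OF x s(1)] by auto
  with s show ?thesis by (intro exI[of _ r]) auto
qed

definition \<tau> :: "real \<Rightarrow> real" where
  "\<tau> x = (THE t. t > 0 \<and> F x t = 0)"

lemma \<tau>:
  assumes x: "0 < x" "x < 1"
  shows "\<tau> x > 0" "F x (\<tau> x) = 0"
proof -
  have "\<exists>!t. t > 0 \<and> F x t = 0"
    using F_has_zero[OF x] F_zero_unique[OF x] by blast
  then have "\<tau> x > 0 \<and> F x (\<tau> x) = 0" unfolding \<tau>_def by (rule theI')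
  then show "\<tau> x > 0" "F x (\<tau> x) = 0" by auto
qed

lemma \<tau>_eqI:
  assumes "0 < x" "x < 1" "t > 0" "F x t = 0"
  shows "\<tau> x = t"
  using \<tau>[of x] F_zero_unique[of x "\<tau> x" t] assms by simp

text \<open>A nonnegative value here, together with the negative values near 0, would produce a
  second zero. \<open>F_pos_above\<close> is the mirror image.\<close>

lemma F_neg_below:
  assumes x: "0 < x" "x < 1" and t: "0 < t" "t < \<tau> x"
  shows "F x t < 0"
proof (rule ccontr)
  assume "\<not> F x t < 0"
  obtain s where s: "s > 0" "s < t" "F x s < 0"
    using eventually_happens'[OF _ eventually_conj[OF F_eventually_neg[OF x]
        eventually_at_right_real[OF t(1)]]] by auto
  obtain r where "s \<le> r" "r \<le> t" "F x r = 0"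
    using IVT'[of "F x" s 0 t] s \<open>\<not> F x t < 0\<close> continuous_on_F[OF x s(1)] by auto
  with \<tau>_eqI[OF x, of r] s t show False by simp
qed

lemma F_pos_above:
  assumes x: "0 < x" "x < 1" and t: "\<tau> x < t"
  shows "F x t > 0"
proof (rule ccontr)
  assume "\<not> F x t > 0"
  have t0: "0 < t" using \<tau>[OF x] t by simp
  obtain s where s: "t \<le> s" "F x s > 0"
    using eventually_happens'[OF _ eventually_conj[OF F_eventually_pos[OF x] eventually_ge_at_top[of t]]]
    by auto
  obtain r where "t \<le> r" "r \<le> s" "F x r = 0"
    using IVT'[of "F x" t 0 s] s \<open>\<not> F x t > 0\<close> continuous_on_F[OF x t0] by auto
  with \<tau>_eqI[OF x, of r] t0 t show False by simp
qed

section \<open>Continuity and differentiability of the implicit function\<close>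

lemma eventually_unit_interval:
  assumes "0 < x" "x < 1"
  shows "\<forall>\<^sub>F y in at x. 0 < y \<and> y < (1::real)"
  using eventually_at_in_open'[of "{0<..<1}" x] assms by simp

text \<open>For a fixed \<open>t\<close> on one side of \<open>\<tau> x\<close> the sign of
  \<open>F y t\<close> persists for \<open>y\<close> near \<open>x\<close>, which keeps
  \<open>\<tau> y\<close> on the other side of \<open>t\<close>.\<close>

lemma isCont_\<tau>:
  assumes x: "0 < x" "x < 1"
  shows "isCont \<tau> x"
  unfolding isCont_def
proof (rule order_tendstoI)
  have F: "((\<lambda>y. F y t) \<longlongrightarrow> F x t) (at x)" if "t > 0" for t
    using DERIV_isCont[OF DERIV_F_fst[OF x that]] by (simp add: isCont_def)
  fix l assume "l < \<tau> x"
  \<comment> \<open>The lower bound \<open>l\<close> may be negative; the maximum keeps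
    \<open>t\<close> in the domain of \<open>F\<close>.\<close>
  define t where "t = max l (\<tau> x / 2)"
  have t: "0 < t" "l \<le> t" "t < \<tau> x" using \<tau>[OF x] \<open>l < \<tau> x\<close> by (auto simp: t_def)
  have "\<forall>\<^sub>F y in at x. F y t < 0"
    using F[OF t(1)] F_neg_below[OF x t(1,3)] by (rule order_tendstoD)
  with eventually_unit_interval[OF x] show "\<forall>\<^sub>F y in at x. l < \<tau> y"
  proof eventually_elim
    case (elim y)
    then show ?case using F_pos_above[of y t] \<tau>[of y] t by (cases "\<tau> y" t rule: linorder_cases) auto
  qed
next
  have F: "((\<lambda>y. F y t) \<longlongrightarrow> F x t) (at x)" if "t > 0" for t
    using DERIV_isCont[OF DERIV_F_fst[OF x that]] by (simp add: isCont_def)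
  fix t assume t: "\<tau> x < t"
  then have t0: "0 < t" using \<tau>[OF x] by simp
  have "\<forall>\<^sub>F y in at x. F y t > 0"
    using F[OF t0] F_pos_above[OF x t] by (rule order_tendstoD)
  with eventually_unit_interval[OF x] show "\<forall>\<^sub>F y in at x. \<tau> y < t"
  proof eventually_elim
    case (elim y)
    then show ?case using F_neg_below[of y t] \<tau>[of y] t0 by (cases "\<tau> y" t rule: linorder_cases) auto
  qed
qed

text \<open>The order of \<open>s\<close> and \<open>t\<close> is left open and \<open>s = t\<close>
  is included, so that an intermediate point exists for every nearby \<open>y\<close> and is
  squeezed by \<open>\<tau> y\<close>.\<close>

lemma F_mean_value:
  assumes x: "0 < x" "x < 1" and st: "0 < s" "0 < t"
  shows "\<exists>\<xi>. \<bar>\<xi> - s\<bar> \<le> \<bar>t - s\<bar> \<and> F x t - F x s = (t - s) * Ft x \<xi>"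
proof (cases s t rule: linorder_cases)
  case less
  have "\<exists>\<xi>>s. \<xi> < t \<and> F x t - F x s = (t - s) * Ft x \<xi>"
    using less st x by (intro MVT2 DERIV_F_snd) auto
  then obtain \<xi> where "s < \<xi>" "\<xi> < t" "F x t - F x s = (t - s) * Ft x \<xi>" by blast
  then show ?thesis by (intro exI[of _ \<xi>]) auto
next
  case greater
  have "\<exists>\<xi>>t. \<xi> < s \<and> F x s - F x t = (s - t) * Ft x \<xi>"
    using greater st x by (intro MVT2 DERIV_F_snd) auto
  then obtain \<xi> where "t < \<xi>" "\<xi> < s" "F x s - F x t = (s - t) * Ft x \<xi>" by blast
  then show ?thesis by (intro exI[of _ \<xi>]) (auto simp: algebra_simps)
qed auto

definition \<tau>' :: "real \<Rightarrow> real" where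
  "\<tau>' x = - Fx x (\<tau> x) / Ft x (\<tau> x)"

text \<open>Since \<open>F\<close> vanishes along the curve, the increment of \<open>F\<close> in
  \<open>x\<close> at the fixed \<open>t = \<tau> x\<close> is minus
  \<open>\<tau> y - \<tau> x\<close> times \<open>Ft y (\<xi> y)\<close>. Continuity of
  \<open>\<tau>\<close> sends \<open>\<xi> y\<close> to \<open>\<tau> x\<close>.\<close>

lemma DERIV_\<tau>:
  assumes x: "0 < x" "x < 1"
  shows "(\<tau> has_real_derivative \<tau>' x) (at x)"
proof -
  let ?t = "\<tau> x"
  have "\<exists>\<xi>. \<bar>\<xi> - ?t\<bar> \<le> \<bar>\<tau> y - ?t\<bar> \<and> F y (\<tau> y) - F y ?t = (\<tau> y - ?t) * Ft y \<xi>"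
    if y: "0 < y" "y < 1" for y
    by (rule F_mean_value[OF y \<tau>(1)[OF x] \<tau>(1)[OF y]])
  then obtain \<xi> where \<xi>: "\<And>y. 0 < y \<Longrightarrow> y < 1 \<Longrightarrow> \<bar>\<xi> y - ?t\<bar> \<le> \<bar>\<tau> y - ?t\<bar>"
    "\<And>y. 0 < y \<Longrightarrow> y < 1 \<Longrightarrow> F y (\<tau> y) - F y ?t = (\<tau> y - ?t) * Ft y (\<xi> y)"
    by metis
  have "((\<lambda>y. \<tau> y - ?t) \<longlongrightarrow> 0) (at x)"
    using isCont_\<tau>[OF x] by (simp add: isCont_def LIM_zero)
  then have "((\<lambda>y. \<xi> y - ?t) \<longlongrightarrow> 0) (at x)"
    by (rule Lim_transform_bound[rotated])
      (use eventually_unit_interval[OF x] in eventually_elim, use \<xi>(1) in auto)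
  then have "(\<xi> \<longlongrightarrow> ?t) (at x)" by (simp add: LIM_zero_iff)
  then have Ft: "((\<lambda>y. Ft y (\<xi> y)) \<longlongrightarrow> Ft x ?t) (at x)"
    using x \<tau>[OF x] by (intro tendsto_Ft tendsto_ident_at) auto
  have Ft_pos': "Ft x ?t > 0" using Ft_pos x \<tau> by blast
  have "((\<lambda>y. (F y ?t - F x ?t) / (y - x)) \<longlongrightarrow> Fx x ?t) (at x)"
    using DERIV_F_fst[OF x \<tau>(1)[OF x]] by (simp add: has_field_derivative_iff)
  with Ft have lim: "((\<lambda>y. - ((F y ?t - F x ?t) / (y - x)) / Ft y (\<xi> y)) \<longlongrightarrow> \<tau>' x) (at x)"
    unfolding \<tau>'_def using Ft_pos' by (intro tendsto_intros) auto
  have "\<forall>\<^sub>F y in at x. Ft y (\<xi> y) > 0" using Ft Ft_pos' by (rule order_tendstoD)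
  with eventually_unit_interval[OF x]
  have "\<forall>\<^sub>F y in at x. - ((F y ?t - F x ?t) / (y - x)) / Ft y (\<xi> y) = (\<tau> y - ?t) / (y - x)"
  proof eventually_elim
    case (elim y)
    then have "- (F y ?t - F x ?t) = (\<tau> y - ?t) * Ft y (\<xi> y)"
      using \<xi>(2)[of y] \<tau>[of y] \<tau>[OF x] by simp
    then have "- ((F y ?t - F x ?t) / (y - x)) = (\<tau> y - ?t) * Ft y (\<xi> y) / (y - x)"
      by (metis minus_divide_left)
    then show ?case using elim by simp
  qed
  from Lim_transform_eventually[OF lim this] show ?thesis
    by (simp add: has_field_derivative_iff)
qed

section \<open>The curvature at the base point\<close>

lemma \<tau>_base: "\<tau> a = 1"
  using a_pos a_less_1 by (intro \<tau>_eqI) (auto simp: F_def L_def)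

text \<open>\<open>L'\<close>, \<open>Fx'\<close> and \<open>Ft'\<close> are total derivatives along the curve \<open>t = \<tau> x\<close>.\<close>

definition L' :: "real \<Rightarrow> real" where
  "L' x = \<gamma> x + (5 / (2 * \<tau> x) + c / (\<tau> x)\<^sup>2) * \<tau>' x"

definition Fx' :: "real \<Rightarrow> real" where
  "Fx' x = (let P = exp (L x (\<tau> x)); Q = exp (- L x (\<tau> x)); B = (1 + x) * \<tau> x; B' = \<tau> x + (1 + x) * \<tau>' x in
     \<gamma>' x * (P * (1 + a) + Q * B) + \<gamma> x * (P * L' x * (1 + a) + Q * B' - Q * L' x * B)
     - (4 + Q) * \<tau>' x + Q * L' x * \<tau> x)"

definition Ft' :: "real \<Rightarrow> real" where
  "Ft' x = (let P = exp (L x (\<tau> x)); Q = exp (- L x (\<tau> x)) in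
     P * L' x * (1 + a) * (5 / (2 * \<tau> x) + c / (\<tau> x)\<^sup>2)
     - P * (1 + a) * (5 / (2 * (\<tau> x)\<^sup>2) + 2 * c / (\<tau> x) ^ 3) * \<tau>' x
     + Q * (1 - L' x * (1 + x)) * (3/2 + c / \<tau> x) - Q * (1 + x) * c * \<tau>' x / (\<tau> x)\<^sup>2 - 4)"

text \<open>The quotient rule for \<open>- Fx / Ft\<close>, with the remaining quotient replaced by
  \<open>\<tau>'\<close> so that only one factor \<open>Ft\<close> is left below.\<close>

definition \<tau>'' :: "real \<Rightarrow> real" where
  "\<tau>'' x = - (Fx' x + \<tau>' x * Ft' x) / Ft x (\<tau> x)"

lemma DERIV_L_\<tau>:
  assumes x: "0 < x" "x < 1"
  shows "((\<lambda>x. L x (\<tau> x)) has_real_derivative L' x) (at x)"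
  using DERIV_L[OF DERIV_ident DERIV_\<tau>[OF x] x \<tau>(1)[OF x]] by (simp add: L'_def)

lemma DERIV_Fx:
  assumes x: "0 < x" "x < 1"
  shows "((\<lambda>x. Fx x (\<tau> x)) has_real_derivative Fx' x) (at x)"
  unfolding Fx_def
  by (rule derivative_eq_intros refl DERIV_L_\<tau>[OF x] DERIV_\<tau>[OF x] DERIV_\<gamma>[OF x])+
    (simp add: Fx'_def Let_def algebra_simps)

lemma DERIV_Ft:
  assumes x: "0 < x" "x < 1"
  shows "((\<lambda>x. Ft x (\<tau> x)) has_real_derivative Ft' x) (at x)"
proof -
  have nz: "\<tau> x \<noteq> 0" "(\<tau> x)\<^sup>2 \<noteq> 0" "2 * \<tau> x \<noteq> 0" using \<tau>[OF x] by simp_all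
  have 1: "((\<lambda>x. 5 / (2 * \<tau> x) + c / (\<tau> x)\<^sup>2) has_real_derivative
      - ((5 / (2 * (\<tau> x)\<^sup>2) + 2 * c / (\<tau> x) ^ 3) * \<tau>' x)) (at x)"
    by (rule derivative_eq_intros refl nz DERIV_\<tau>[OF x])+
      (use nz in \<open>simp add: divide_simps power2_eq_square power3_eq_cube, simp add: algebra_simps\<close>)
  have 2: "((\<lambda>x. 3/2 + c / \<tau> x) has_real_derivative - (c * \<tau>' x / (\<tau> x)\<^sup>2)) (at x)"
    by (rule derivative_eq_intros refl nz DERIV_\<tau>[OF x])+
      (use nz in \<open>simp add: power2_eq_square\<close>)
  show ?thesis
    unfolding Ft_def
    by (rule 1 2 derivative_eq_intros refl DERIV_L_\<tau>[OF x])+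
      (simp add: Ft'_def Let_def algebra_simps add_divide_distrib)
qed

lemma DERIV_\<tau>':
  assumes x: "0 < x" "x < 1"
  shows "(\<tau>' has_real_derivative \<tau>'' x) (at x)"
proof -
  have "Ft x (\<tau> x) \<noteq> 0" using Ft_pos[OF x \<tau>[OF x]] by simp
  then have "(- Fx' x * Ft x (\<tau> x) - - Fx x (\<tau> x) * Ft' x) / (Ft x (\<tau> x) * Ft x (\<tau> x)) = \<tau>'' x"
    unfolding \<tau>''_def \<tau>'_def by (simp add: divide_simps)
  with DERIV_divide[OF DERIV_minus[OF DERIV_Fx[OF x]] DERIV_Ft[OF x] \<open>Ft x (\<tau> x) \<noteq> 0\<close>]
  show ?thesis by (simp add: \<tau>'_def[abs_def])
qed

lemma isCont_\<tau>'':
  assumes x: "0 < x" "x < 1"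
  shows "isCont \<tau>'' x"
proof -
  note base = DERIV_isCont[OF DERIV_\<tau>[OF x]] DERIV_isCont[OF DERIV_\<tau>'[OF x]]
    DERIV_isCont[OF DERIV_L_\<tau>[OF x]] DERIV_isCont[OF DERIV_\<gamma>[OF x]] DERIV_isCont[OF DERIV_Ft[OF x]]
  note rules = isCont_add isCont_diff isCont_minus isCont_mult isCont_divide isCont_power isCont_exp'
    continuous_const continuous_ident
  have nz: "\<tau> x \<noteq> 0" "Ft x (\<tau> x) \<noteq> 0" "x * (1 - x\<^sup>2) \<noteq> 0"
    using \<tau>[OF x] Ft_pos[OF x \<tau>[OF x]] x square_less_1[OF x] by auto
  have 1: "isCont \<gamma>' x"
    unfolding \<gamma>'_def using nz by (intro rules) auto
  have 2: "isCont L' x"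
    unfolding L'_def using nz by (intro base rules) auto
  have 3: "isCont Fx' x"
    unfolding Fx'_def Let_def by (intro base 1 2 rules)
  have 4: "isCont Ft' x"
    unfolding Ft'_def Let_def using nz by (intro base 2 rules) auto
  show ?thesis
    unfolding \<tau>''_def using nz by (intro base 3 4 rules)
qed

lemma \<tau>''_neg:
  assumes a: "a \<le> 1/4" and c: "c > 37.5964"
  shows "\<tau>'' a < 0"
proof -
  define A where "A = 1 + a"
  \<comment> \<open>As \<open>a * (1 - a\<^sup>2)\<close> contains the factor \<open>A\<close>,
    scaling by \<open>A\<close> turns the derivatives at the base point into polynomials in
    \<open>w\<close>, \<open>S\<close>, \<open>c\<close> and \<open>K\<close>.\<close>
  define w where "w = 1 / (a * (1 - a))"
  define S where "S = A * \<tau>' a"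
  define \<Lambda> where "\<Lambda> = A * L' a"
  define K where "K = 4 * (1 - 3 * a\<^sup>2) * w\<^sup>2"
  have pos: "a > 0" "1 - a > 0" "A > 0" "c > 0" using a_pos a_less_1 c by (simp_all add: A_def)
  have fact: "a * (1 - a\<^sup>2) = a * (1 - a) * A" by (simp add: A_def power2_eq_square algebra_simps)
  have \<gamma>: "A * \<gamma> a = - 2 * w" using pos by (simp add: \<gamma>_def fact w_def)
  have \<gamma>': "2 * A\<^sup>2 * \<gamma>' a = K"
    using pos by (simp add: \<gamma>'_def fact w_def K_def power_mult_distrib power_divide)
  have L0: "L a 1 = 0" by (simp add: L_def)
  have Ft: "Ft a 1 = 2 * c * A" by (simp add: Ft_def L0 A_def field_simps)
  have "Fx a 1 = 2 * (A * \<gamma> a) - 2 * c - 5" by (simp add: Fx_def L0 A_def algebra_simps)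
  then have "\<tau>' a = (2 * c + 5 + 4 * w) / (2 * c * A)"
    by (simp add: \<tau>'_def \<tau>_base Ft \<gamma>)
  then have S: "2 * c * S = 2 * c + 5 + 4 * w" using pos by (simp add: S_def)
  have \<Lambda>: "\<Lambda> = - 2 * w + (5/2 + c) * S"
    unfolding \<Lambda>_def L'_def \<tau>_base S_def \<gamma>[symmetric] by (simp add: algebra_simps)
  have "2 * w = - (A * \<gamma> a)" using \<gamma> by simp
  then have Fx': "A * Fx' a = K - 2 * w * (1 + S) - 5 * S + \<Lambda>"
    unfolding \<gamma>'[symmetric] \<Lambda>_def S_def Fx'_def Let_def
    by (simp only:) (simp add: \<tau>_base L0 A_def power2_eq_square algebra_simps)
  have Ft': "Ft' a = \<Lambda> + c - 5/2 - (5/2 + 3 * c) * S"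
    unfolding \<Lambda>_def S_def Ft'_def Let_def
    by (simp add: \<tau>_base L0 A_def power2_eq_square algebra_simps)
  \<comment> \<open>Eliminating \<open>w\<close> makes the next identity polynomial in
    \<open>c\<close> and \<open>S\<close>, apart from the additive \<open>K\<close>; completing the
    square gives \<open>(S - 1)\<^sup>2\<close>.\<close>
  have w': "w = (2 * c * S - 2 * c - 5) / 4" using S by simp
  have "A * (Fx' a + \<tau>' a * Ft' a) = A * Fx' a + S * Ft' a"
    by (simp add: S_def algebra_simps)
  also have "\<dots> = K - (4 * c * (S - 1)\<^sup>2 + 10 + 12 * w)"
    unfolding Fx' Ft' \<Lambda> w' by (simp add: power2_eq_square field_simps)
  also have "4 * c * (S - 1)\<^sup>2 = (4 * w + 5)\<^sup>2 / c"
  proof -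
    have "4 * w + 5 = 2 * c * (S - 1)" using S by (simp add: algebra_simps)
    then show ?thesis using pos by (simp add: power2_eq_square)
  qed
  also have "K - ((4 * w + 5)\<^sup>2 / c + 10 + 12 * w) > 0"
    using ineq_curvature[OF a_pos a c w_def] by (simp add: K_def)
  finally have "Fx' a + \<tau>' a * Ft' a > 0" using pos by (simp add: zero_less_mult_iff)
  then show ?thesis using pos unfolding \<tau>''_def \<tau>_base Ft by (intro divide_neg_pos) auto
qed

section \<open>The Hugoniot locus in physical variables\<close>

text \<open>The Saha constant cancels in the quotient, and with \<open>Ti = c * T\<^sub>0\<close>
  the logarithm depends on the temperatures only through \<open>T / T\<^sub>0\<close>.\<close>

lemma pressure_ratio:
  assumes "\<kappa> > 0" "T\<^sub>0 > 0" "0 < x" "x < 1" "T > 0"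
  shows "pressure \<kappa> (c * T\<^sub>0) x T / pressure \<kappa> (c * T\<^sub>0) a T\<^sub>0 = exp (L x (T / T\<^sub>0))"
proof -
  have press: "pressure \<kappa> (c * T\<^sub>0) y T = exp (ln ((1 - y\<^sup>2) / y\<^sup>2) + 5/2 * ln T + - (c * T\<^sub>0) / T) / \<kappa>"
    if "0 < y" "y < 1" "T > 0" for y T
  proof -
    define r where "r = (1 - y\<^sup>2) / y\<^sup>2"
    have "r > 0" using square_less_1[of y] that by (simp add: r_def)
    then show ?thesis
      unfolding pressure_def r_def[symmetric] exp_add using that by (simp add: powr_def)
  qed
  have "L x (T / T\<^sub>0) = ln ((1 - x\<^sup>2) / x\<^sup>2) + 5/2 * ln T + - (c * T\<^sub>0) / T
      - (ln ((1 - a\<^sup>2) / a\<^sup>2) + 5/2 * ln T\<^sub>0 + - (c * T\<^sub>0) / T\<^sub>0)"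
    using assms by (simp add: L_def ln_div diff_divide_distrib algebra_simps)
  then show ?thesis
    using assms a_pos a_less_1 by (simp add: press exp_diff)
qed

lemma mem_hugoniot_locus_iff:
  assumes \<kappa>: "\<kappa> > 0" and T\<^sub>0: "T\<^sub>0 > 0"
  shows "(x, T) \<in> hugoniot_locus \<kappa> (c * T\<^sub>0) a T\<^sub>0 \<longleftrightarrow> 0 < x \<and> x < 1 \<and> 0 < T \<and> F x (T / T\<^sub>0) = 0"
proof (cases "0 < x \<and> x < 1 \<and> 0 < T")
  case True
  define p where "p = pressure \<kappa> (c * T\<^sub>0) x T"
  define p\<^sub>0 where "p\<^sub>0 = pressure \<kappa> (c * T\<^sub>0) a T\<^sub>0"
  have P: "p / p\<^sub>0 = exp (L x (T / T\<^sub>0))"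
    unfolding p_def p\<^sub>0_def using True \<kappa> T\<^sub>0 by (intro pressure_ratio) auto
  then have Q: "p\<^sub>0 / p = exp (- L x (T / T\<^sub>0))"
    by (metis exp_minus inverse_divide)
  have "T\<^sub>0 * F x (T / T\<^sub>0) = (4 + p / p\<^sub>0) * ((1 + a) * T\<^sub>0) + 2 * (c * T\<^sub>0) * a
      - ((4 + p\<^sub>0 / p) * ((1 + x) * T) + 2 * (c * T\<^sub>0) * x)"
  proof -
    define t where "t = T / T\<^sub>0"
    have "T = T\<^sub>0 * t" using T\<^sub>0 by (simp add: t_def)
    then show ?thesis unfolding F_def P Q t_def[symmetric] by (simp add: algebra_simps)
  qed
  then show ?thesis
    using True T\<^sub>0 by (auto simp: hugoniot_locus_def Let_def theta_def simp flip: p_def p\<^sub>0_def)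
qed (auto simp: hugoniot_locus_def)

lemma hugoniot_locus_eq_graph:
  assumes "\<kappa> > 0" "T\<^sub>0 > 0"
  shows "hugoniot_locus \<kappa> (c * T\<^sub>0) a T\<^sub>0 = {(x, T\<^sub>0 * \<tau> x) | x. x \<in> {0<..<1}}"
proof -
  have "(x, T) \<in> hugoniot_locus \<kappa> (c * T\<^sub>0) a T\<^sub>0 \<longleftrightarrow> 0 < x \<and> x < 1 \<and> T = T\<^sub>0 * \<tau> x" for x T
  proof -
    have "0 < T \<and> F x (T / T\<^sub>0) = 0 \<longleftrightarrow> T = T\<^sub>0 * \<tau> x" if x: "0 < x" "x < 1"
      using \<tau>[OF x] \<tau>_eqI[OF x, of "T / T\<^sub>0"] assms by auto
    then show ?thesis unfolding mem_hugoniot_locus_iff[OF assms] by blast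
  qed
  then show ?thesis by auto
qed

end

theorem corollary2p1:
  fixes \<kappa> Ti \<alpha>\<^sub>0 T\<^sub>0 :: real
  assumes "\<kappa> > 0" and "Ti > 0" and "T\<^sub>0 > 0"
    and "Ti / T\<^sub>0 > 37.5964"
    and "0 < \<alpha>\<^sub>0" and "\<alpha>\<^sub>0 \<le> 0.25"
  shows "\<exists>T :: real \<Rightarrow> real.
           hugoniot_locus \<kappa> Ti \<alpha>\<^sub>0 T\<^sub>0 = {(\<alpha>, T \<alpha>) | \<alpha>. \<alpha> \<in> {0<..<1}} \<and>
           (\<exists>\<epsilon>>0. {\<alpha>\<^sub>0 - \<epsilon><..<\<alpha>\<^sub>0 + \<epsilon>} \<subseteq> {0<..<1} \<and>
                  strictly_concave_on {\<alpha>\<^sub>0 - \<epsilon><..<\<alpha>\<^sub>0 + \<epsilon>} T)"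
proof -
  define c where "c = Ti / T\<^sub>0"
  have Ti: "Ti = c * T\<^sub>0" using assms by (simp add: c_def)
  have c: "c > 37.5964" and \<alpha>\<^sub>0: "\<alpha>\<^sub>0 \<le> 1/4" using assms by (simp_all add: c_def)
  interpret hugoniot \<alpha>\<^sub>0 c
    by unfold_locales (use assms c in auto)
  \<comment> \<open>Taking the whole unit interval as the open set also yields the required
    inclusion. Scaling by \<open>T\<^sub>0\<close> then returns to physical temperature.\<close>
  obtain \<epsilon> where \<epsilon>: "\<epsilon> > 0" "{\<alpha>\<^sub>0 - \<epsilon><..<\<alpha>\<^sub>0 + \<epsilon>} \<subseteq> {0<..<1}"
    "strictly_concave_on {\<alpha>\<^sub>0 - \<epsilon><..<\<alpha>\<^sub>0 + \<epsilon>} \<tau>"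
    by (rule strictly_concave_on_nhd[of "{0<..<1}" \<alpha>\<^sub>0 \<tau> \<tau>' \<tau>''])
      (use a_pos a_less_1 in \<open>auto intro: DERIV_\<tau> DERIV_\<tau>' isCont_\<tau>'' \<tau>''_neg[OF \<alpha>\<^sub>0 c]\<close>)
  have "strictly_concave_on {\<alpha>\<^sub>0 - \<epsilon><..<\<alpha>\<^sub>0 + \<epsilon>} (\<lambda>x. T\<^sub>0 * \<tau> x)"
    using \<epsilon>(3) assms by (intro strictly_concave_on_cmult) auto
  moreover have "hugoniot_locus \<kappa> Ti \<alpha>\<^sub>0 T\<^sub>0 = {(\<alpha>, T\<^sub>0 * \<tau> \<alpha>) | \<alpha>. \<alpha> \<in> {0<..<1}}"
    unfolding Ti using assms by (intro hugoniot_locus_eq_graph) auto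
  ultimately show ?thesis using \<epsilon>(1,2) by (intro exI[of _ "\<lambda>x. T\<^sub>0 * \<tau> x"]) blast
qed

end
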